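(* For an integer base $b\ge 2$ and an integer $n>0$, let $N_{\mathrm{card}}(b)=(b-1)\bigl(\lfloor \log_b n\rfloor+1\bigr)$ be the number of cards required to guess any integer between $1$ and $n$ in the base-$b$ guessing scheme. Then for every integer $n>0$ and every integer base $b>2$, \[ N_{\mathrm{card}}(2)=\lfloor \log_2 n\rfloor+1\;\le\; N_{\mathrm{card}}(b)=(b-1)\bigl(\lfloor \log_b n\rfloor+1\bigr). \] Moreover, equality holds only in the following cases: (1) $b=3$ and $n=8$, where both sides equal $4$; (2) $b=3$ and $n=2$, where both sides equal $2$. In all other cases the inequality is strict.
   Context: Here $\lfloor x\rfloor$ denotes the floor of the real number $x$. The base-$b$ guessing scheme: integers are written in base $b$ with digits $0,\dots,b-1$. For each power $b^i$ with $0\le i\le p$, where $p=\lfloor \log_b n\rfloor$ is the highest power of $b$ needed to represent $n$, there are $b-1$ cards, one for each nonzero coefficient $c\in\{1,\dots,b-1\}$; the card for $(i,c)$ lists the numbers whose base-$b$ expansion has digit $c$ at $b^i$. A player indicates the cards on which the secret number appears. The total number of cards is therefore counted as $N_{\mathrm{card}}(b)=(b-1)(p+1)=(b-1)(\lfloor\log_b n\rfloor+1)$, with a full block of $b-1$ cards for every power used. *)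

theory Defs
  imports Complex_Main
begin

definition highest_power :: "nat \<Rightarrow> nat \<Rightarrow> nat" where
  "highest_power b n = nat \<lfloor>log (real b) (real n)\<rfloor>"

definition base_digit :: "nat \<Rightarrow> nat \<Rightarrow> nat \<Rightarrow> nat" where
  "base_digit b m i = (m div b ^ i) mod b"

definition listed_numbers :: "nat \<Rightarrow> nat \<Rightarrow> nat \<Rightarrow> nat \<Rightarrow> nat set" where
  "listed_numbers b n i c = {m \<in> {1..n}. base_digit b m i = c}"

(* A card carries its label (i, c) together with the numbers it lists.  The label keeps
   cards apart that list the same numbers: when n < (b - 1) * b ^ p, where p is the highest
   power, some of the cards for b ^ p are empty, and they still count, since every power
   comes with a full block of b - 1 cards. *)
definition deck :: "nat \<Rightarrow> nat \<Rightarrow> (nat \<times> nat \<times> nat set) set" where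
  "deck b n =
     {(i, c, listed_numbers b n i c) | i c. i \<in> {0..highest_power b n} \<and> c \<in> {1..b - 1}}"

definition N_card :: "nat \<Rightarrow> nat \<Rightarrow> nat" where
  "N_card b n = card (deck b n)"

end

theory Submission
  imports Defs
begin

text \<open>Let \<open>p = \<lfloor>log\<^sub>2 n\<rfloor>\<close> and let \<open>k\<close> be the number of base-\<open>b\<close> digits of \<open>n\<close>, so that
  \<open>2 ^ p \<le> n < b ^ k\<close>.  If \<open>b \<ge> 4\<close>, then \<open>b \<le> 2 ^ (b - 2)\<close>, hence \<open>p < (b - 2) * k\<close>, which leaves
  room for a strict inequality.  If \<open>b = 3\<close> and \<open>p + 1 \<ge> 2 * k\<close>, then \<open>4 ^ k < 2 * 3 ^ k\<close>, so
  \<open>k \<le> 2\<close>, and the two values of \<open>k\<close> give the two exceptions.\<close>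

lemma N_card_eq: "N_card b n = (b - 1) * (highest_power b n + 1)"
proof -
  have "deck b n = (\<lambda>(i, c). (i, c, listed_numbers b n i c)) ` ({0..highest_power b n} \<times> {1..b - 1})"
    by (auto simp: deck_def image_iff)
  \<comment> \<open>The label is part of the card, so empty or coinciding lists do not merge
    cards.\<close>
  moreover have "inj_on (\<lambda>(i, c). (i, c, listed_numbers b n i c)) A" for A
    by (auto simp: inj_on_def)
  ultimately show ?thesis
    by (simp add: N_card_def card_image card_cartesian_product)
qed

text \<open>Since \<open>n \<ge> 1\<close>, the logarithm is nonnegative, so \<open>nat\<close>
  truncates nothing.\<close>

lemma
  assumes "b \<ge> 2" "n > 0"
  shows int_highest_power: "int (highest_power b n) = \<lfloor>log (real b) (real n)\<rfloor>"
    and highest_power_le: "b ^ highest_power b n \<le> n"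
    and less_highest_power: "n < b ^ (highest_power b n + 1)"
proof -
  show int: "int (highest_power b n) = \<lfloor>log (real b) (real n)\<rfloor>"
    using assms by (simp add: highest_power_def)
  have "b ^ highest_power b n \<le> n \<and> n < b ^ (highest_power b n + 1)"
    using floor_log_nat_eq_powr_iff[of b n "highest_power b n"] assms int by simp
  then show "b ^ highest_power b n \<le> n" "n < b ^ (highest_power b n + 1)"
    by auto
qed

lemma highest_power_eqI:
  assumes "b \<ge> 2" "n > 0" "b ^ q \<le> n" "n < b ^ (q + 1)"
  shows "highest_power b n = q"
  using assms floor_log_nat_eq_powr_iff[of b n q] by (simp add: highest_power_def)

text \<open>Equality at \<open>b = 4\<close>; after that the right side doubles at each step. It
  fails at \<open>b = 3\<close>, which is why base 3 is treated apart.\<close>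

lemma le_two_power_diff_2:
  fixes b :: nat
  assumes "b \<ge> 4"
  shows "b \<le> 2 ^ (b - 2)"
  using assms
proof (induction b rule: dec_induct)
  case (step m)
  then have "Suc m - 2 = Suc (m - 2)" by simp
  then have "(2::nat) ^ (Suc m - 2) = 2 * 2 ^ (m - 2)" by simp
  with step show ?case by linarith
qed simp

text \<open>The threshold is sharp: 54 < 64 at \<open>k = 3\<close>, but 18 > 16 at
  \<open>k = 2\<close>.\<close>

lemma four_power_gt:
  fixes k :: nat
  assumes "k \<ge> 3"
  shows "2 * 3 ^ k < (4::nat) ^ k"
  using assms by (induction k rule: dec_induct) simp_all

lemma digits_bound_base_ge_4:
  fixes b p k :: nat
  assumes "b \<ge> 4" "k > 0" "2 ^ p < b ^ k"
  shows "p + 1 < (b - 1) * k"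
proof -
  have "(2::nat) ^ p < (2 ^ (b - 2)) ^ k"
    using assms(3) power_mono[OF le_two_power_diff_2[OF assms(1)], of k] by simp
  then have "(2::nat) ^ p < 2 ^ ((b - 2) * k)"
    by (simp add: power_mult)
  then have "p < (b - 2) * k" by simp
  \<comment> \<open>The extra summand \<open>k > 0\<close> makes the final inequality
    strict.\<close>
  moreover have "(b - 1) * k = (b - 2) * k + k"
    using assms(1) by (cases b) (auto simp: algebra_simps Suc_diff_le numeral_2_eq_2)
  ultimately show ?thesis using assms(2) by linarith
qed

text \<open>Used contrapositively: the last hypothesis negates the strict inequality for
  \<open>b - 1 = 2\<close>.\<close>

lemma digits_bound_base_3:
  fixes n p k :: nat
  assumes "k > 0" "2 ^ p \<le> n" "n < 3 ^ k" "2 * k \<le> p + 1"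
  shows "n = 2 \<or> n = 8"
proof -
  have "(4::nat) ^ k = 2 ^ (2 * k)" by (simp add: power_mult)
  also have "\<dots> \<le> 2 ^ (p + 1)" using assms(4) by (intro power_increasing) auto
  also have "\<dots> < 2 * 3 ^ k" using assms(2,3) by simp
  finally have "k < 3" using four_power_gt[of k] by linarith
  then consider "k = 1" | "k = 2" using assms(1) by linarith
  then show ?thesis
  proof cases
    case 1
    \<comment> \<open>Otherwise \<open>4 \<le> n < 3\<close>. With \<open>p = 1\<close> only
      \<open>2 \<le> n < 3\<close> remains.\<close>
    then have "p < 2" using power_increasing[of 2 p "2::nat"] assms(2,3) by fastforce
    then have "p = 1" using 1 assms(4) by simp
    with 1 assms(2,3) show ?thesis by simp
  next
    case 2
    \<comment> \<open>Otherwise \<open>16 \<le> n < 9\<close>. With \<open>p = 3\<close> only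
      \<open>8 \<le> n < 9\<close> remains.\<close>
    then have "p < 4" using power_increasing[of 4 p "2::nat"] assms(2,3) by fastforce
    then have "p = 3" using 2 assms(4) by simp
    with 2 assms(2,3) show ?thesis by simp
  qed
qed

theorem theorem1:
  fixes b n :: nat
  assumes "n > 0" and "b > 2"
  shows "int (N_card 2 n) = \<lfloor>log 2 (real n)\<rfloor> + 1
    \<and> int (N_card b n) = (int b - 1) * (\<lfloor>log (real b) (real n)\<rfloor> + 1)
    \<and> N_card 2 n \<le> N_card b n
    \<and> (N_card 2 n = N_card b n \<longleftrightarrow> (b = 3 \<and> n = 8) \<or> (b = 3 \<and> n = 2))
    \<and> (\<not> ((b = 3 \<and> n = 8) \<or> (b = 3 \<and> n = 2)) \<longrightarrow> N_card 2 n < N_card b n)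
    \<and> (b = 3 \<and> n = 8 \<longrightarrow> N_card 2 n = 4 \<and> N_card b n = 4)
    \<and> (b = 3 \<and> n = 2 \<longrightarrow> N_card 2 n = 2 \<and> N_card b n = 2)"
proof -
  define p where "p = highest_power 2 n"
  define k where "k = highest_power b n + 1"
  have card2: "N_card 2 n = p + 1" and cardb: "N_card b n = (b - 1) * k"
    by (simp_all add: N_card_eq p_def k_def)
  have int2: "int (N_card 2 n) = \<lfloor>log 2 (real n)\<rfloor> + 1"
    using int_highest_power[of 2 n] assms by (simp add: card2 p_def)
  have intb: "int (N_card b n) = (int b - 1) * (\<lfloor>log (real b) (real n)\<rfloor> + 1)"
    using int_highest_power[of b n] assms by (simp add: cardb k_def of_nat_diff del: mult_Suc_right)
  have p: "2 ^ p \<le> n"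
    using highest_power_le[of 2 n] assms by (simp add: p_def)
  have k: "k > 0" "n < b ^ k"
    using less_highest_power[of b n] assms by (simp_all add: k_def)
  \<comment> \<open>Powers enclosing 2 and 8: \<open>2 \<le> 2 < 4\<close> and
    \<open>1 \<le> 2 < 3\<close>, then \<open>8 \<le> 8 < 16\<close> and
    \<open>3 \<le> 8 < 9\<close>.\<close>
  have n2: "p = 1 \<and> k = 1" if "b = 3" "n = 2"
    using that highest_power_eqI[of 2 2 1] highest_power_eqI[of 3 2 0] by (simp add: p_def k_def)
  have n8: "p = 3 \<and> k = 2" if "b = 3" "n = 8"
    using that highest_power_eqI[of 2 8 3] highest_power_eqI[of 3 8 1] by (simp add: p_def k_def)
  have strict: "p + 1 < (b - 1) * k" if "\<not> ((b = 3 \<and> n = 8) \<or> (b = 3 \<and> n = 2))"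
  proof (cases "b = 3")
    case True
    then show ?thesis using digits_bound_base_3[of k p n] k p that by fastforce
  next
    case False
    then show ?thesis using digits_bound_base_ge_4[of b k p] assms k p by linarith
  qed
  show ?thesis
    using int2 intb strict n2 n8 unfolding card2 cardb by fastforce
qed

end
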